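(* Let $\Theta\subseteq\mathbb{R}$ and let $\{p(\cdot|\theta),\ \theta\in\Theta\}$ be a family of probability density functions of an observation vector $\boldsymbol{X}=(X_1,\ldots,X_n)$. Let $\rho:\mathbb{R}\to[0,\infty)$ be a loss function that is non-increasing on $(-\infty,0]$, non-decreasing on $[0,\infty)$, satisfies $\rho(0)=0$, and is convex and symmetric ($\rho(-\epsilon)=\rho(\epsilon)$ for all $\epsilon$). Then the minimax risk satisfies $$R_n(\Theta)\ \ge\ \sup_{\theta_0,\theta_1\in\Theta}\left\{2\,\rho\left(\frac{\theta_1-\theta_0}{2}\right)\cdot\sup_{0\le q\le 1}P_{\mathrm{e}}(q,\theta_0,\theta_1)\right\}.$$
   Context: The alphabet $\mathcal{X}\subseteq\mathbb{R}$ is the set of values of each $X_i$, and each $p(\cdot|\theta)$ is regarded as a probability density on $\mathbb{R}^n$ vanishing outside $\mathcal{X}^n$ (in the discrete case densities are probability mass functions and integrals are sums). $\mathbf{E}_\theta$ denotes expectation when $\boldsymbol{X}\sim p(\cdot|\theta)$. An estimator is a (measurable) function $g_n:\mathcal{X}^n\to\Theta$. The minimax risk is $$R_n(\Theta)=\inf_{g_n}\sup_{\theta\in\Theta}\mathbf{E}_\theta\{\rho(g_n[\boldsymbol{X}]-\theta)\},$$ the infimum being over all estimators. For $q\in[0,1]$ and $\theta_0,\theta_1\in\Theta$, $$P_{\mathrm{e}}(q,\theta_0,\theta_1)=\int_{\mathbb{R}^n}\min\{q\,p(\boldsymbol{x}|\theta_0),(1-q)\,p(\boldsymbol{x}|\theta_1)\}\,d\boldsymbol{x},$$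 which is the error probability of the optimal (MAP) test between $p(\cdot|\theta_0)$ and $p(\cdot|\theta_1)$ with priors $q$ and $1-q$. *)

theory Defs
  imports "HOL-Probability.Probability"
begin

text \<open>
  Observation vectors are elements of \<open>real ^ 'n\<close>, so \<open>n = CARD('n)\<close>.
  Risks and error probabilities are \<open>ennreal\<close>-valued: a supremum of risks may be infinite.
\<close>

definition vectors_over :: "real set \<Rightarrow> (real ^ 'n) set" where
  "vectors_over \<X> = {x. \<forall>i. x $ i \<in> \<X>}"

text \<open>
  The measure with respect to which densities are taken: Lebesgue measure in the continuous
  case, counting measure in the discrete case. Every subset of a countable \<open>vectors_over \<X>\<close>
  is Borel, so using the full power set as \<open>\<sigma>\<close>-algebra in the discrete case does not
  enlarge the set of estimators.
\<close>

definition reference_measure :: "real set \<Rightarrow> (real ^ 'n) measure \<Rightarrow> bool" where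
  "reference_measure \<X> M \<longleftrightarrow> M = lborel \<or> (countable \<X> \<and> M = count_space UNIV)"

definition observation_law ::
    "(real ^ 'n) measure \<Rightarrow> (real \<Rightarrow> real ^ 'n \<Rightarrow> real) \<Rightarrow> real \<Rightarrow> (real ^ 'n) measure" where
  "observation_law M p \<theta> = density M (\<lambda>x. ennreal (p \<theta> x))"

definition density_family ::
    "real set \<Rightarrow> (real ^ 'n) measure \<Rightarrow> real set \<Rightarrow> (real \<Rightarrow> real ^ 'n \<Rightarrow> real) \<Rightarrow> bool" where
  "density_family \<X> M \<Theta> p \<longleftrightarrow>
     (\<forall>\<theta>\<in>\<Theta>. p \<theta> \<in> borel_measurable M \<and> (\<forall>x. 0 \<le> p \<theta> x) \<and>
        (\<forall>x. x \<notin> vectors_over \<X> \<longrightarrow> p \<theta> x = 0) \<and>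
        prob_space (observation_law M p \<theta>))"

text \<open>
  Estimators are total functions here, but only their restriction to \<open>vectors_over \<X>\<close> is
  constrained; their values elsewhere do not affect the risk since densities vanish there.
\<close>

definition estimators ::
    "real set \<Rightarrow> (real ^ 'n) measure \<Rightarrow> real set \<Rightarrow> (real ^ 'n \<Rightarrow> real) set" where
  "estimators \<X> M \<Theta> =
     measurable (restrict_space M (vectors_over \<X>)) (restrict_space borel \<Theta>)"

definition minimax_risk ::
    "real set \<Rightarrow> (real ^ 'n) measure \<Rightarrow> real set \<Rightarrow> (real \<Rightarrow> real ^ 'n \<Rightarrow> real) \<Rightarrow>
     (real \<Rightarrow> real) \<Rightarrow> ennreal" where
  "minimax_risk \<X> M \<Theta> p \<rho> =
     (INF g\<in>estimators \<X> M \<Theta>. SUP \<theta>\<in>\<Theta>.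
        \<integral>\<^sup>+ x. ennreal (\<rho> (g x - \<theta>)) \<partial>observation_law M p \<theta>)"

definition error_prob ::
    "(real ^ 'n) measure \<Rightarrow> (real \<Rightarrow> real ^ 'n \<Rightarrow> real) \<Rightarrow> real \<Rightarrow> real \<Rightarrow> real \<Rightarrow> ennreal" where
  "error_prob M p q \<theta>\<^sub>0 \<theta>\<^sub>1 =
     (\<integral>\<^sup>+ x. ennreal (min (q * p \<theta>\<^sub>0 x) ((1 - q) * p \<theta>\<^sub>1 x)) \<partial>M)"

end

theory Submission
  imports Defs
begin

text \<open>
  The supremum over the parameters dominates the Bayes risk with weights \<open>q\<close> and \<open>1 - q\<close> on
  \<open>\<theta>\<^sub>0\<close> and \<open>\<theta>\<^sub>1\<close>. Its integrand is at least
  \<open>min {q p(x|\<theta>\<^sub>0), (1 - q) p(x|\<theta>\<^sub>1)} (\<rho> (g x - \<theta>\<^sub>0) + \<rho> (\<theta>\<^sub>1 - g x))\<close> by symmetry, and by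
  midpoint convexity the last factor is at least \<open>2 \<rho> ((\<theta>\<^sub>1 - \<theta>\<^sub>0) / 2)\<close>, whatever \<open>g x\<close> is.
\<close>

lemma convex_even_two_point:
  fixes \<rho> :: "real \<Rightarrow> real"
  assumes "convex_on UNIV \<rho>" and "\<And>\<epsilon>. \<rho> (- \<epsilon>) = \<rho> \<epsilon>"
  shows "2 * \<rho> ((b - a) / 2) \<le> \<rho> (t - a) + \<rho> (t - b)"
proof -
  \<comment> \<open>The points \<open>t - a\<close> and \<open>b - t\<close> are taken because
    \<open>t\<close> cancels in their midpoint; symmetry then turns the second loss back into one of
    \<open>t - b\<close>.\<close>
  have "\<rho> ((1/2) *\<^sub>R (t - a) + (1/2) *\<^sub>R (b - t)) \<le> 1/2 * \<rho> (t - a) + 1/2 * \<rho> (b - t)"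
    using convex_onD[OF assms(1), of "1/2" "t - a" "b - t"] by simp
  also have "(1/2) *\<^sub>R (t - a) + (1/2) *\<^sub>R (b - t) = (b - a) / 2"
    by (simp add: field_simps)
  also have "\<rho> (b - t) = \<rho> (t - b)"
    using assms(2)[of "t - b"] by simp
  finally show ?thesis by linarith
qed

text \<open>Applied with \<open>s\<close> the worst-case risk: averaging two risks over a prior
  cannot exceed their supremum. Risks may be infinite, hence \<open>ennreal\<close>.\<close>

lemma ennreal_convex_combination_le:
  fixes a b s :: ennreal
  assumes "a \<le> s" "b \<le> s" "0 \<le> q" "q \<le> 1"
  shows "ennreal q * a + ennreal (1 - q) * b \<le> s"
proof -
  have "ennreal q * a + ennreal (1 - q) * b \<le> ennreal q * s + ennreal (1 - q) * s"
    by (intro add_mono mult_left_mono assms) simp_all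
  also have "\<dots> = (ennreal q + ennreal (1 - q)) * s"
    by (simp add: distrib_right)
  also have "ennreal q + ennreal (1 - q) = 1"
    using assms by (simp flip: ennreal_plus)
  finally show ?thesis by simp
qed

text \<open>
  The loss \<open>f\<close> may be non-measurable off the set \<open>A\<close>, where \<open>nn_integral\<close> is only a lower
  integral; one inequality survives.
\<close>

lemma nn_integral_density_ge_measurable_part:
  assumes "h \<in> borel_measurable M" "A \<in> sets M"
    and "f \<in> borel_measurable (restrict_space M A)"
  shows "(\<integral>\<^sup>+ x. h x * (f x * indicator A x) \<partial>M) \<le> (\<integral>\<^sup>+ x. f x \<partial>density M h)"
proof -
  have "(\<lambda>x. f x * indicator A x) \<in> borel_measurable M"
    using assms by (subst borel_measurable_restrict_space_iff_ennreal[symmetric]) auto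
  then have "(\<integral>\<^sup>+ x. h x * (f x * indicator A x) \<partial>M) = (\<integral>\<^sup>+ x. f x * indicator A x \<partial>density M h)"
    using assms by (simp add: nn_integral_density)
  also have "\<dots> \<le> (\<integral>\<^sup>+ x. f x \<partial>density M h)"
    by (intro nn_integral_mono) (auto simp: indicator_def)
  finally show ?thesis .
qed

lemma weighted_risk_ge_error_prob:
  fixes M :: "(real ^ 'n) measure"
  assumes dens: "density_family \<X> M \<Theta> p" "\<theta>\<^sub>0 \<in> \<Theta>" "\<theta>\<^sub>1 \<in> \<Theta>"
    and g: "g \<in> estimators \<X> M \<Theta>"
    and \<rho>: "\<And>\<epsilon>. 0 \<le> \<rho> \<epsilon>" "convex_on UNIV \<rho>" "\<And>\<epsilon>. \<rho> (- \<epsilon>) = \<rho> \<epsilon>"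
    and q: "0 \<le> q" "q \<le> 1"
  shows "ennreal (2 * \<rho> ((\<theta>\<^sub>1 - \<theta>\<^sub>0) / 2)) * error_prob M p q \<theta>\<^sub>0 \<theta>\<^sub>1
    \<le> ennreal q * (\<integral>\<^sup>+ x. ennreal (\<rho> (g x - \<theta>\<^sub>0)) \<partial>observation_law M p \<theta>\<^sub>0)
      + ennreal (1 - q) * (\<integral>\<^sup>+ x. ennreal (\<rho> (g x - \<theta>\<^sub>1)) \<partial>observation_law M p \<theta>\<^sub>1)"
proof -
  let ?V = "vectors_over \<X> :: (real ^ 'n) set"
  let ?c = "\<rho> ((\<theta>\<^sub>1 - \<theta>\<^sub>0) / 2)"
  \<comment> \<open>An estimator is measurable only on \<open>vectors_over \<X>\<close>, which
    itself may fail to be measurable. The common support \<open>A\<close> of the two densities is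
    measurable, lies inside that set, and carries all of the error probability.\<close>
  define A where "A = {x \<in> space M. p \<theta>\<^sub>0 x \<noteq> 0 \<and> p \<theta>\<^sub>1 x \<noteq> 0}"
  \<comment> \<open>Cutting the loss off to \<open>A\<close> makes it measurable on all of
    \<open>M\<close>, which the additivity of the integral below relies on.\<close>
  define L where "L \<theta> x = ennreal (\<rho> (g x - \<theta>)) * indicator A x" for \<theta> x
  have p_meas [measurable]: "p \<theta>\<^sub>0 \<in> borel_measurable M" "p \<theta>\<^sub>1 \<in> borel_measurable M"
    and p_nonneg: "0 \<le> p \<theta>\<^sub>0 x" "0 \<le> p \<theta>\<^sub>1 x" for x
    using dens by (auto simp: density_family_def)
  have A [measurable]: "A \<in> sets M"
    unfolding A_def by measurable
  have "A \<subseteq> ?V"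
    using dens by (auto simp: A_def density_family_def)
  have "g \<in> borel_measurable (restrict_space M ?V)"
    using g by (auto simp: estimators_def measurable_restrict_space2_iff)
  then have "g \<in> borel_measurable (restrict_space M A)"
    using \<open>A \<subseteq> ?V\<close> by (rule measurable_restrict_mono)
  moreover have "\<rho> \<in> borel_measurable borel"
    using convex_on_continuous[OF open_UNIV \<rho>(2)] by (rule borel_measurable_continuous_onI)
  ultimately have loss: "(\<lambda>x. ennreal (\<rho> (g x - \<theta>))) \<in> borel_measurable (restrict_space M A)" for \<theta>
    by measurable
  then have [measurable]: "L \<theta> \<in> borel_measurable M" for \<theta>
    unfolding L_def using A by (subst borel_measurable_restrict_space_iff_ennreal[symmetric]) auto
  have pointwise: "ennreal (2 * ?c) * ennreal (min (q * p \<theta>\<^sub>0 x) ((1 - q) * p \<theta>\<^sub>1 x))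
      \<le> ennreal q * (ennreal (p \<theta>\<^sub>0 x) * L \<theta>\<^sub>0 x) + ennreal (1 - q) * (ennreal (p \<theta>\<^sub>1 x) * L \<theta>\<^sub>1 x)"
    if "x \<in> space M" for x
  proof (cases "x \<in> A")
    case True
    let ?m = "min (q * p \<theta>\<^sub>0 x) ((1 - q) * p \<theta>\<^sub>1 x)"
    have "0 \<le> ?m"
      using q p_nonneg by simp
    have "2 * ?c * ?m \<le> (\<rho> (g x - \<theta>\<^sub>0) + \<rho> (g x - \<theta>\<^sub>1)) * ?m"
      using convex_even_two_point[OF \<rho>(2,3)] \<open>0 \<le> ?m\<close> by (rule mult_right_mono)
    also have "\<dots> = ?m * \<rho> (g x - \<theta>\<^sub>0) + ?m * \<rho> (g x - \<theta>\<^sub>1)"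
      by (simp add: algebra_simps)
    \<comment> \<open>The minimum is bounded by a different argument in each summand, so that each
      loss meets its own density.\<close>
    also have "\<dots> \<le> q * p \<theta>\<^sub>0 x * \<rho> (g x - \<theta>\<^sub>0) + (1 - q) * p \<theta>\<^sub>1 x * \<rho> (g x - \<theta>\<^sub>1)"
      by (intro add_mono mult_right_mono \<rho>) simp_all
    finally have "ennreal (2 * ?c * ?m)
        \<le> ennreal (q * (p \<theta>\<^sub>0 x * \<rho> (g x - \<theta>\<^sub>0)) + (1 - q) * (p \<theta>\<^sub>1 x * \<rho> (g x - \<theta>\<^sub>1)))"
      by (intro ennreal_leI) (simp add: mult.assoc)
    then show ?thesis
      using True q p_nonneg \<rho>(1) \<open>0 \<le> ?m\<close>
      by (simp add: L_def ennreal_mult ennreal_plus)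
  next
    case False
    then have "p \<theta>\<^sub>0 x = 0 \<or> p \<theta>\<^sub>1 x = 0"
      using that by (auto simp: A_def)
    then have "min (q * p \<theta>\<^sub>0 x) ((1 - q) * p \<theta>\<^sub>1 x) = 0"
      using q p_nonneg by (auto simp: min_absorb1 min_absorb2)
    then show ?thesis by simp
  qed
  have "ennreal (2 * ?c) * error_prob M p q \<theta>\<^sub>0 \<theta>\<^sub>1
      = (\<integral>\<^sup>+ x. ennreal (2 * ?c) * ennreal (min (q * p \<theta>\<^sub>0 x) ((1 - q) * p \<theta>\<^sub>1 x)) \<partial>M)"
    unfolding error_prob_def by (subst nn_integral_cmult) simp_all
  also have "\<dots> \<le> (\<integral>\<^sup>+ x. ennreal q * (ennreal (p \<theta>\<^sub>0 x) * L \<theta>\<^sub>0 x)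
      + ennreal (1 - q) * (ennreal (p \<theta>\<^sub>1 x) * L \<theta>\<^sub>1 x) \<partial>M)"
    by (intro nn_integral_mono pointwise)
  also have "\<dots> = ennreal q * (\<integral>\<^sup>+ x. ennreal (p \<theta>\<^sub>0 x) * L \<theta>\<^sub>0 x \<partial>M)
      + ennreal (1 - q) * (\<integral>\<^sup>+ x. ennreal (p \<theta>\<^sub>1 x) * L \<theta>\<^sub>1 x \<partial>M)"
    by (simp add: nn_integral_add nn_integral_cmult)
  \<comment> \<open>Restoring the full loss outside \<open>A\<close> can only increase the two
    risks.\<close>
  also have "\<dots> \<le> ennreal q * (\<integral>\<^sup>+ x. ennreal (\<rho> (g x - \<theta>\<^sub>0)) \<partial>observation_law M p \<theta>\<^sub>0)
      + ennreal (1 - q) * (\<integral>\<^sup>+ x. ennreal (\<rho> (g x - \<theta>\<^sub>1)) \<partial>observation_law M p \<theta>\<^sub>1)"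
    unfolding observation_law_def L_def
    by (intro add_mono mult_left_mono nn_integral_density_ge_measurable_part loss A) simp_all
  finally show ?thesis .
qed

theorem theorem1:
  fixes \<X> \<Theta> :: "real set"
    and M :: "(real ^ 'n) measure"
    and p :: "real \<Rightarrow> real ^ 'n \<Rightarrow> real"
    and \<rho> :: "real \<Rightarrow> real"
  assumes "reference_measure \<X> M"
    and "density_family \<X> M \<Theta> p"
    and "\<And>\<epsilon>. 0 \<le> \<rho> \<epsilon>"
    and "antimono_on {..0} \<rho>"
    and "mono_on {0..} \<rho>"
    and "\<rho> 0 = 0"
    and "convex_on UNIV \<rho>"
    and "\<And>\<epsilon>. \<rho> (- \<epsilon>) = \<rho> \<epsilon>"
  shows "minimax_risk \<X> M \<Theta> p \<rho> \<ge>
    (SUP (\<theta>\<^sub>0, \<theta>\<^sub>1) \<in> \<Theta> \<times> \<Theta>.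
       ennreal (2 * \<rho> ((\<theta>\<^sub>1 - \<theta>\<^sub>0) / 2)) * (SUP q\<in>{0..1}. error_prob M p q \<theta>\<^sub>0 \<theta>\<^sub>1))"
proof -
  have "ennreal (2 * \<rho> ((\<theta>\<^sub>1 - \<theta>\<^sub>0) / 2)) * (SUP q\<in>{0..1}. error_prob M p q \<theta>\<^sub>0 \<theta>\<^sub>1)
      \<le> (SUP \<theta>\<in>\<Theta>. \<integral>\<^sup>+ x. ennreal (\<rho> (g x - \<theta>)) \<partial>observation_law M p \<theta>)"
    (is "_ \<le> ?S")
    if "g \<in> estimators \<X> M \<Theta>" "\<theta>\<^sub>0 \<in> \<Theta>" "\<theta>\<^sub>1 \<in> \<Theta>" for g \<theta>\<^sub>0 \<theta>\<^sub>1
  proof -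
    \<comment> \<open>One \<open>q\<close> at a time suffices: in \<open>ennreal\<close> a constant
      factor commutes with the supremum.\<close>
    have "ennreal (2 * \<rho> ((\<theta>\<^sub>1 - \<theta>\<^sub>0) / 2)) * error_prob M p q \<theta>\<^sub>0 \<theta>\<^sub>1 \<le> ?S"
      if "q \<in> {0..1}" for q
    proof -
      have "ennreal (2 * \<rho> ((\<theta>\<^sub>1 - \<theta>\<^sub>0) / 2)) * error_prob M p q \<theta>\<^sub>0 \<theta>\<^sub>1
        \<le> ennreal q * (\<integral>\<^sup>+ x. ennreal (\<rho> (g x - \<theta>\<^sub>0)) \<partial>observation_law M p \<theta>\<^sub>0)
          + ennreal (1 - q) * (\<integral>\<^sup>+ x. ennreal (\<rho> (g x - \<theta>\<^sub>1)) \<partial>observation_law M p \<theta>\<^sub>1)"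
        using assms(2,3,7,8) \<open>g \<in> _\<close> \<open>\<theta>\<^sub>0 \<in> \<Theta>\<close> \<open>\<theta>\<^sub>1 \<in> \<Theta>\<close> that
        by (intro weighted_risk_ge_error_prob) auto
      also have "\<dots> \<le> ?S"
        using \<open>\<theta>\<^sub>0 \<in> \<Theta>\<close> \<open>\<theta>\<^sub>1 \<in> \<Theta>\<close> that
        by (intro ennreal_convex_combination_le SUP_upper) auto
      finally show ?thesis .
    qed
    then show ?thesis
      by (auto simp: SUP_mult_left_ennreal intro!: SUP_least)
  qed
  \<comment> \<open>The bound is uniform in \<open>g\<close>, so it passes to the infimum; without
    any estimator that infimum is infinite and the claim still holds.\<close>
  then show ?thesis
    unfolding minimax_risk_def by (auto intro!: INF_greatest SUP_least)
qed

end
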